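(* Let $\theta>0$ and let $M$ be either the Plancherel measure $M_\infty$ or the $z$-measure $M_z$ with $z\in\mathbb C$, $z\notin\mathbb Z+\mathbb Z\theta$ (both $\kappa_\theta$-central probability measures on $\mathrm{Tab}$ as described in the context). Then every box $(i,j)$ is completely reachable with respect to $M$, i.e. for $M$-almost every $\tau\in\mathrm{Tab}$ one has $(i,j)\in\bigcup_n\tau^n$.
   Context: Young graph: vertices are Young diagrams (including $\varnothing$); $\mu\nearrow\lambda$ if $\lambda$ is obtained from $\mu$ by adding one box. $\mathrm{Tab}$ is the set of infinite paths $\tau=(\varnothing\nearrow\tau^1\nearrow\tau^2\nearrow\dots)$ (infinite standard Young tableaux) with the projective-limit topology; for a finite path $\sigma=(\varnothing\nearrow\sigma^1\nearrow\dots\nearrow\sigma^n)$, $\mathrm{Cyl}(\sigma)=\{\tau:\tau^m=\sigma^m,\ m\le n\}$. Boxes $(r,s)$: row $r$, column $s$. For a diagram $\mu$ with rows $\mu_1\ge\mu_2\ge\dots$ and conjugate $\mu'$, $a_\mu(r,s)=\mu_r-s$, $\ell_\mu(r,s)=\mu'_s-r$. Jack edge multiplicities: if $\lambda=\mu\cup\{(i,j)\}$, $\kappa_\theta(\mu,\lambda)=\prod_{k=1}^{i-1}\frac{(a+(\ell+2)\theta)(a+1+\ell\theta)}{(a+(\ell+1)\theta)(a+1+(\ell+1)\theta)}$ with $a=\mu_k-j$, $\ell=\mu'_j-k$; for a finite path $\kappa_\theta(\sigma)=\prod_m\kappa_\theta(\sigma^{m-1},\sigma^m)$. Put $H'_\theta(\lambda)=\prod_{b\in\lambda}(a_\lambda(b)+\theta\ell_\lambda(b)+\theta)$,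 $c_\theta(r,s)=(s-1)-(r-1)\theta$, $(x)_n=x(x+1)\cdots(x+n-1)$, $\varphi_\infty(\lambda)=\theta^{|\lambda|}/H'_\theta(\lambda)$ and $\varphi_z(\lambda)=\frac{\prod_{b\in\lambda}|z+c_\theta(b)|^2}{(\theta^{-1}|z|^2)_{|\lambda|}H'_\theta(\lambda)}$. $M_\infty$ (resp. $M_z$) is the probability measure on $\mathrm{Tab}$ with $M(\mathrm{Cyl}(\sigma))=\kappa_\theta(\sigma)\varphi(\lambda)$ for every finite path $\sigma$ ending at $\lambda$, where $\varphi=\varphi_\infty$ (resp. $\varphi=\varphi_z$); these measures exist. *)

theory Defs
  imports "HOL-Probability.Probability"
begin

text \<open>
  Boxes are pairs (row, column), both counted from 1. A Young diagram is represented by its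
  finite set of boxes.
\<close>

type_synonym box = "nat \<times> nat"
type_synonym diagram = "box set"

definition young_diagram :: "diagram \<Rightarrow> bool" where
  "young_diagram \<mu> \<longleftrightarrow> finite \<mu> \<and> (\<forall>(r, s) \<in> \<mu>. 1 \<le> r \<and> 1 \<le> s) \<and>
     (\<forall>(r, s) \<in> \<mu>. \<forall>r' s'. 1 \<le> r' \<longrightarrow> r' \<le> r \<longrightarrow> 1 \<le> s' \<longrightarrow> s' \<le> s \<longrightarrow> (r', s') \<in> \<mu>)"

definition young_edge :: "diagram \<Rightarrow> diagram \<Rightarrow> bool" (infix "\<nearrow>" 50) where
  "\<mu> \<nearrow> \<nu> \<longleftrightarrow> young_diagram \<mu> \<and> young_diagram \<nu> \<and> (\<exists>b. b \<notin> \<mu> \<and> \<nu> = insert b \<mu>)"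

definition row_len :: "diagram \<Rightarrow> nat \<Rightarrow> nat" where
  "row_len \<mu> r = card {s. (r, s) \<in> \<mu>}"

definition col_len :: "diagram \<Rightarrow> nat \<Rightarrow> nat" where
  "col_len \<mu> s = card {r. (r, s) \<in> \<mu>}"

definition arm :: "diagram \<Rightarrow> box \<Rightarrow> real" where
  "arm \<mu> = (\<lambda>(r, s). real (row_len \<mu> r) - real s)"

definition leg :: "diagram \<Rightarrow> box \<Rightarrow> real" where
  "leg \<mu> = (\<lambda>(r, s). real (col_len \<mu> s) - real r)"

definition Tab :: "(nat \<Rightarrow> diagram) set" where
  "Tab = {\<tau>. \<tau> 0 = {} \<and> (\<forall>n. \<tau> n \<nearrow> \<tau> (Suc n))}"

text \<open>
  The projective limit of the finite discrete sets of paths of length n, realised as a subspace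
  of the product of discrete spaces.
\<close>

definition tab_topology :: "(nat \<Rightarrow> diagram) topology" where
  "tab_topology = subtopology (product_topology (\<lambda>_. discrete_topology UNIV) UNIV) Tab"

definition tab_borel :: "(nat \<Rightarrow> diagram) measure" where
  "tab_borel = sigma Tab {U. openin tab_topology U}"

text \<open>
  A finite path of length n is given by a function of which only the values at 0, ..., n matter.
\<close>

definition finite_path :: "nat \<Rightarrow> (nat \<Rightarrow> diagram) \<Rightarrow> bool" where
  "finite_path n \<sigma> \<longleftrightarrow> \<sigma> 0 = {} \<and> (\<forall>m<n. \<sigma> m \<nearrow> \<sigma> (Suc m))"

definition Cyl :: "nat \<Rightarrow> (nat \<Rightarrow> diagram) \<Rightarrow> (nat \<Rightarrow> diagram) set" where
  "Cyl n \<sigma> = {\<tau> \<in> Tab. \<forall>m\<le>n. \<tau> m = \<sigma> m}"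

text \<open>
  The formula is meaningful when the second diagram arises from the first by adding one box
  (i, j), which is then the unique element of the difference.
\<close>

definition jack_mult :: "real \<Rightarrow> diagram \<Rightarrow> diagram \<Rightarrow> real" where
  "jack_mult \<theta> \<mu> \<nu> = (let (i, j) = the_elem (\<nu> - \<mu>) in
     \<Prod>k\<in>{1..<i}. let a = arm \<mu> (k, j); l = leg \<mu> (k, j) in
       ((a + (l + 2) * \<theta>) * (a + 1 + l * \<theta>)) /
       ((a + (l + 1) * \<theta>) * (a + 1 + (l + 1) * \<theta>)))"

definition path_mult :: "real \<Rightarrow> nat \<Rightarrow> (nat \<Rightarrow> diagram) \<Rightarrow> real" where
  "path_mult \<theta> n \<sigma> = (\<Prod>m\<in>{1..n}. jack_mult \<theta> (\<sigma> (m - 1)) (\<sigma> m))"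

definition hook_prod :: "real \<Rightarrow> diagram \<Rightarrow> real" where
  "hook_prod \<theta> \<nu> = (\<Prod>b\<in>\<nu>. arm \<nu> b + \<theta> * leg \<nu> b + \<theta>)"

definition content :: "real \<Rightarrow> box \<Rightarrow> real" where
  "content \<theta> = (\<lambda>(r, s). (real s - 1) - (real r - 1) * \<theta>)"

definition phi_plancherel :: "real \<Rightarrow> diagram \<Rightarrow> real" where
  "phi_plancherel \<theta> \<nu> = \<theta> ^ card \<nu> / hook_prod \<theta> \<nu>"

definition phi_z :: "real \<Rightarrow> complex \<Rightarrow> diagram \<Rightarrow> real" where
  "phi_z \<theta> z \<nu> = (\<Prod>b\<in>\<nu>. (cmod (z + of_real (content \<theta> b)))\<^sup>2) /
     (pochhammer ((cmod z)\<^sup>2 / \<theta>) (card \<nu>) * hook_prod \<theta> \<nu>)"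

definition central_measure_of ::
    "real \<Rightarrow> (diagram \<Rightarrow> real) \<Rightarrow> (nat \<Rightarrow> diagram) measure \<Rightarrow> bool" where
  "central_measure_of \<theta> \<phi> M \<longleftrightarrow> prob_space M \<and> space M = Tab \<and> sets M = sets tab_borel \<and>
     (\<forall>n \<sigma>. finite_path n \<sigma> \<longrightarrow> measure M (Cyl n \<sigma>) = path_mult \<theta> n \<sigma> * \<phi> (\<sigma> n))"

definition plancherel_measure :: "real \<Rightarrow> (nat \<Rightarrow> diagram) measure \<Rightarrow> bool" where
  "plancherel_measure \<theta> M \<longleftrightarrow> central_measure_of \<theta> (phi_plancherel \<theta>) M"

definition z_measure :: "real \<Rightarrow> complex \<Rightarrow> (nat \<Rightarrow> diagram) measure \<Rightarrow> bool" where
  "z_measure \<theta> z M \<longleftrightarrow> central_measure_of \<theta> (phi_z \<theta> z) M"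

definition completely_reachable :: "(nat \<Rightarrow> diagram) measure \<Rightarrow> box \<Rightarrow> bool" where
  "completely_reachable M b \<longleftrightarrow> (AE \<tau> in M. b \<in> (\<Union>n. \<tau> n))"

end

theory Submission
  imports Defs
begin

text \<open>
  Induct on the box \<open>b = (i, j)\<close>. Once its left and upper neighbours are present, \<open>b\<close> stays addable
  until it is added. While it is addable, only the hooks in row \<open>i\<close> and column \<open>j\<close> (boundedly many)
  change by adding it, each by a bounded factor, so the transition probability from a diagram with
  \<open>n\<close> boxes is at least a constant for the Plancherel measure and at least \<open>c / (t + n)\<close> for the
  z-measure; there \<open>c > 0\<close> because \<open>z\<close> avoids the lattice. As these bounds have a
  divergent sum, \<open>b\<close> is added almost surely.
\<close>

section \<open>Addable boxes\<close>

lemma young_edge_insertD: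
  assumes "\<mu> \<nearrow> insert b \<mu>"
  shows "young_diagram \<mu>" "young_diagram (insert b \<mu>)" "b \<notin> \<mu>"
  using assms unfolding young_edge_def by auto

lemma young_diagram_down:
  assumes "young_diagram \<mu>" "(r, s) \<in> \<mu>" "1 \<le> r'" "r' \<le> r" "1 \<le> s'" "s' \<le> s"
  shows "(r', s') \<in> \<mu>"
  using assms unfolding young_diagram_def by blast

lemma young_diagram_pos:
  assumes "young_diagram \<mu>" "(r, s) \<in> \<mu>"
  shows "1 \<le> r" "1 \<le> s"
  using assms unfolding young_diagram_def by auto

text \<open>Downward closure has to be checked only at the two immediate neighbours: any other box
  weakly above and to the left of \<open>(i, j)\<close> lies weakly above and to the left of one of
  them. In the first row or first column the corresponding neighbour condition is vacuous.\<close>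

lemma young_edge_insertI:
  assumes "young_diagram \<mu>" "(i, j) \<notin> \<mu>" "1 \<le> i" "1 \<le> j"
    and "1 < i \<Longrightarrow> (i - 1, j) \<in> \<mu>" "1 < j \<Longrightarrow> (i, j - 1) \<in> \<mu>"
  shows "\<mu> \<nearrow> insert (i, j) \<mu>"
proof -
  have *: "(r, s) \<in> insert (i, j) \<mu>" if "1 \<le> r" "r \<le> i" "1 \<le> s" "s \<le> j" for r s
  proof (cases "r < i")
    case True
    then show ?thesis
      using young_diagram_down[OF assms(1) assms(5), of r s] that by auto
  next
    case False
    then show ?thesis
      using young_diagram_down[OF assms(1) assms(6), of r s] that by (cases "s < j") auto
  qed
  have "young_diagram (insert (i, j) \<mu>)"
    unfolding young_diagram_def
  proof (intro conjI ballI)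
    show "finite (insert (i, j) \<mu>)"
      using assms(1) by (simp add: young_diagram_def)
    show "case x of (r, s) \<Rightarrow> 1 \<le> r \<and> 1 \<le> s" if "x \<in> insert (i, j) \<mu>" for x
      using that assms(3,4) young_diagram_pos[OF assms(1)] by fastforce
    show "case x of (r, s) \<Rightarrow> \<forall>r' s'. 1 \<le> r' \<longrightarrow> r' \<le> r \<longrightarrow> 1 \<le> s' \<longrightarrow> s' \<le> s \<longrightarrow>
        (r', s') \<in> insert (i, j) \<mu>" if "x \<in> insert (i, j) \<mu>" for x
      using that * young_diagram_down[OF assms(1)] by fastforce
  qed
  then show ?thesis
    using assms(1,2) unfolding young_edge_def by blast
qed

text \<open>The neighbours that make \<open>b\<close> addable to \<open>\<mu>\<close> remain present
  in the larger diagram. Hence along a path a box stays addable until it is added.\<close>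

lemma young_edge_insert_mono:
  assumes "\<mu> \<nearrow> insert b \<mu>" "\<mu> \<subseteq> \<nu>" "young_diagram \<nu>" "b \<notin> \<nu>"
  shows "\<nu> \<nearrow> insert b \<nu>"
proof -
  obtain i j where b: "b = (i, j)" by (cases b)
  have y: "young_diagram (insert (i, j) \<mu>)"
    using young_edge_insertD[OF assms(1)] b by simp
  have pos: "1 \<le> i" "1 \<le> j"
    using young_diagram_pos[OF y] by auto
  show ?thesis
    unfolding b
  proof (rule young_edge_insertI)
    show "(i - 1, j) \<in> \<nu>" if "1 < i"
      using young_diagram_down[OF y, of i j "i - 1" j] that pos assms(2) by fastforce
    show "(i, j - 1) \<in> \<nu>" if "1 < j"
      using young_diagram_down[OF y, of i j i "j - 1"] that pos assms(2) by fastforce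
  qed (use assms b pos in auto)
qed

section \<open>Rows, columns, arms and legs\<close>

lemma finite_row: "young_diagram \<mu> \<Longrightarrow> finite {s. (r, s) \<in> \<mu>}"
  unfolding young_diagram_def by (rule finite_subset[of _ "snd ` \<mu>"]) force+

lemma finite_col: "young_diagram \<mu> \<Longrightarrow> finite {r. (r, s) \<in> \<mu>}"
  unfolding young_diagram_def by (rule finite_subset[of _ "fst ` \<mu>"]) force+

lemma arm_nonneg:
  assumes "young_diagram \<mu>" "(r, s) \<in> \<mu>"
  shows "0 \<le> arm \<mu> (r, s)"
proof -
  have "{1..s} \<subseteq> {s'. (r, s') \<in> \<mu>}"
    using young_diagram_down[OF assms] young_diagram_pos[OF assms] by auto
  from card_mono[OF finite_row[OF assms(1)] this] show ?thesis
    by (simp add: arm_def row_len_def)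
qed

lemma leg_nonneg:
  assumes "young_diagram \<mu>" "(r, s) \<in> \<mu>"
  shows "0 \<le> leg \<mu> (r, s)"
proof -
  have "{1..r} \<subseteq> {r'. (r', s) \<in> \<mu>}"
    using young_diagram_down[OF assms] young_diagram_pos[OF assms] by auto
  from card_mono[OF finite_col[OF assms(1)] this] show ?thesis
    by (simp add: leg_def col_len_def)
qed

section \<open>Bounds for the transition weights\<close>

text \<open>This uniform lower bound lets a bounded additive change of a hook be absorbed into a
  constant factor.\<close>

lemma hook_ge:
  assumes "young_diagram \<mu>" "x \<in> \<mu>" "\<theta> > 0"
  shows "\<theta> \<le> arm \<mu> x + \<theta> * leg \<mu> x + \<theta>"
  using arm_nonneg[of \<mu> "fst x" "snd x"] leg_nonneg[of \<mu> "fst x" "snd x"] assms by simp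

lemma hook_prod_pos:
  assumes "young_diagram \<mu>" "\<theta> > 0"
  shows "0 < hook_prod \<theta> \<mu>"
  unfolding hook_prod_def
  by (rule prod_pos) (use hook_ge[OF assms(1) _ assms(2)] assms(2) in force)

lemma arm_insert:
  assumes "young_diagram \<mu>" "(i, j) \<notin> \<mu>"
  shows "arm (insert (i, j) \<mu>) (r, s) = arm \<mu> (r, s) + (if r = i then 1 else 0)"
proof (cases "r = i")
  case True
  have "{s. (i, s) \<in> insert (i, j) \<mu>} = insert j {s. (i, s) \<in> \<mu>}" by auto
  with True show ?thesis
    using assms(2) finite_row[OF assms(1)] by (simp add: arm_def row_len_def)
qed (simp add: arm_def row_len_def)

lemma leg_insert:
  assumes "young_diagram \<mu>" "(i, j) \<notin> \<mu>"
  shows "leg (insert (i, j) \<mu>) (r, s) = leg \<mu> (r, s) + (if s = j then 1 else 0)"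
proof (cases "s = j")
  case True
  have "{r. (r, j) \<in> insert (i, j) \<mu>} = insert i {r. (r, j) \<in> \<mu>}" by auto
  with True show ?thesis
    using assms(2) finite_col[OF assms(1)] by (simp add: leg_def col_len_def)
qed (simp add: leg_def col_len_def)

text \<open>A box of \<open>\<mu>\<close> further out in row \<open>i\<close> or column
  \<open>j\<close> would force \<open>(i, j)\<close> into \<open>\<mu>\<close> by downward closure.
  So this row and column are short, whatever the size of \<open>\<mu>\<close>.\<close>

lemma addable_row_col:
  assumes "\<mu> \<nearrow> insert (i, j) \<mu>"
  shows "{s. (i, s) \<in> \<mu>} = {1..<j}" "{r. (r, j) \<in> \<mu>} = {1..<i}"
proof -
  note y = young_edge_insertD[OF assms]
  have pos: "1 \<le> i" "1 \<le> j"
    using young_diagram_pos[OF y(2)] by auto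
  have "s < j" "1 \<le> s" if "(i, s) \<in> \<mu>" for s
    using young_diagram_down[OF y(1) that, of i j] young_diagram_pos[OF y(1) that] pos y(3)
    by (force, blast)
  moreover have "(i, s) \<in> \<mu>" if "1 \<le> s" "s < j" for s
    using young_diagram_down[OF y(2), of i j i s] that pos by auto
  ultimately show "{s. (i, s) \<in> \<mu>} = {1..<j}" by auto
  have "r < i" "1 \<le> r" if "(r, j) \<in> \<mu>" for r
    using young_diagram_down[OF y(1) that, of i j] young_diagram_pos[OF y(1) that] pos y(3)
    by (force, blast)
  moreover have "(r, j) \<in> \<mu>" if "1 \<le> r" "r < i" for r
    using young_diagram_down[OF y(2), of i j r j] that pos by auto
  ultimately show "{r. (r, j) \<in> \<mu>} = {1..<i}" by auto
qed

text \<open>Only the hooks of boxes in row \<open>i\<close> or column \<open>j\<close> change. There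
  are fewer than \<open>i + j\<close> of these, each grows at most by the factor
  \<open>2 + 1 / \<theta>\<close>, and the new corner contributes the factor
  \<open>\<theta>\<close>.\<close>

lemma hook_prod_insert_le:
  assumes "\<mu> \<nearrow> insert (i, j) \<mu>" "\<theta> > 0"
  shows "hook_prod \<theta> (insert (i, j) \<mu>) \<le> \<theta> * (2 + 1 / \<theta>) ^ (i + j) * hook_prod \<theta> \<mu>"
proof -
  note y = young_edge_insertD[OF assms(1)]
  have pos: "1 \<le> i" "1 \<le> j"
    using young_diagram_pos[OF y(2)] by auto
  have fin: "finite \<mu>" using y(1) by (simp add: young_diagram_def)
  define C where "C = 2 + 1 / \<theta>"
  have C: "1 \<le> C" using assms(2) by (simp add: C_def)
  define h where "h = (\<lambda>\<nu> x. arm \<nu> x + \<theta> * leg \<nu> x + \<theta>)"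
  \<comment> \<open>A set containing every box of \<open>\<mu>\<close> whose hook changes; it
    depends on \<open>(i, j)\<close> alone, and so does the final constant.\<close>
  define R where "R = {i} \<times> {1..<j} \<union> {1..<i} \<times> {j}"
  have R: "x \<in> R" if "x \<in> \<mu>" "fst x = i \<or> snd x = j" for x
    using that addable_row_col[OF assms(1)] by (cases x) (auto simp: R_def set_eq_iff)
  have "card R \<le> card ({i} \<times> {1..<j}) + card ({1..<i} \<times> {j})"
    unfolding R_def by (rule card_Un_le)
  then have cardR: "card R \<le> i + j" by simp
  have finR: "finite R" by (simp add: R_def)
  \<comment> \<open>Arm and leg are real valued and defined off the diagram too. Just outside it
    both equal -1, so insertion turns them into 0.\<close>
  have arm0: "arm \<mu> (i, j) = -1" and leg0: "leg \<mu> (i, j) = -1"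
    using addable_row_col[OF assms(1)] pos by (simp_all add: arm_def leg_def row_len_def col_len_def)
  have "h (insert (i, j) \<mu>) (i, j) = \<theta>"
    by (simp add: h_def arm_insert[OF y(1,3)] leg_insert[OF y(1,3)] arm0 leg0)
  then have "hook_prod \<theta> (insert (i, j) \<mu>) = \<theta> * (\<Prod>x\<in>\<mu>. h (insert (i, j) \<mu>) x)"
    using fin y(3) by (simp add: hook_prod_def h_def)
  also have "(\<Prod>x\<in>\<mu>. h (insert (i, j) \<mu>) x) \<le> (\<Prod>x\<in>\<mu>. (if x \<in> R then C else 1) * h \<mu> x)"
  proof (rule prod_mono, safe)
    fix r s assume rs: "(r, s) \<in> \<mu>"
    have ge: "\<theta> \<le> h \<mu> (r, s)"
      using hook_ge[OF y(1) rs assms(2)] by (simp add: h_def)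
    show "0 \<le> h (insert (i, j) \<mu>) (r, s)"
      using hook_ge[OF y(2) _ assms(2), of "(r, s)"] rs assms(2) by (simp add: h_def)
    have eq: "h (insert (i, j) \<mu>) (r, s) =
        h \<mu> (r, s) + (if r = i then 1 else 0) + (if s = j then \<theta> else 0)"
      by (simp add: h_def arm_insert[OF y(1,3)] leg_insert[OF y(1,3)] algebra_simps)
    show "h (insert (i, j) \<mu>) (r, s) \<le> (if (r, s) \<in> R then C else 1) * h \<mu> (r, s)"
    proof (cases "r = i \<or> s = j")
      case True
      \<comment> \<open>The increment is at most \<open>1 + \<theta>\<close>; as the old hook
        \<open>h\<close> is at least \<open>\<theta>\<close>, the 1 is bounded by
        \<open>h / \<theta>\<close> and the \<open>\<theta>\<close> by \<open>h\<close>.\<close>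
      have "1 \<le> h \<mu> (r, s) / \<theta>" using ge assms(2) by simp
      moreover have "C * h \<mu> (r, s) = 2 * h \<mu> (r, s) + h \<mu> (r, s) / \<theta>"
        by (simp add: C_def algebra_simps)
      ultimately have "h (insert (i, j) \<mu>) (r, s) \<le> C * h \<mu> (r, s)"
        using ge assms(2) unfolding eq by (simp only: split: if_split) linarith
      then show ?thesis using R[OF rs] True by simp
    next
      case False
      have "1 * h \<mu> (r, s) \<le> (if (r, s) \<in> R then C else 1) * h \<mu> (r, s)"
        by (rule mult_right_mono) (use C ge assms(2) in auto)
      then show ?thesis using False unfolding eq by simp
    qed
  qed
  also have "\<dots> = C ^ card (\<mu> \<inter> R) * hook_prod \<theta> \<mu>"
    using fin by (simp add: prod.distrib hook_prod_def h_def prod.If_cases)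
  also have "\<dots> \<le> C ^ (i + j) * hook_prod \<theta> \<mu>"
  proof (rule mult_right_mono[OF power_increasing])
    show "card (\<mu> \<inter> R) \<le> i + j"
      using card_mono[OF finR, of "\<mu> \<inter> R"] cardR by simp
  qed (use C hook_prod_pos[OF y(1) assms(2)] in auto)
  finally show ?thesis
    using assms(2) by (simp add: C_def mult.assoc)
qed

text \<open>The factors belong to the \<open>i - 1\<close> boxes above the new one, which lie in
  \<open>\<mu>\<close> and thus have nonnegative arm and leg. Each factor splits into a ratio that
  is at least 1 and a ratio that is at least \<open>1 / (1 + \<theta>)\<close>.\<close>

lemma jack_mult_insert_ge:
  assumes "\<mu> \<nearrow> insert (i, j) \<mu>" "\<theta> > 0"
  shows "(1 / (1 + \<theta>)) ^ (i - 1) \<le> jack_mult \<theta> \<mu> (insert (i, j) \<mu>)"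
proof -
  note y = young_edge_insertD[OF assms(1)]
  have "insert (i, j) \<mu> - \<mu> = {(i, j)}" using y(3) by auto
  moreover have "(\<Prod>k\<in>{1..<i}. 1 / (1 + \<theta>)) \<le>
     (\<Prod>k\<in>{1..<i}. let a = arm \<mu> (k, j); l = leg \<mu> (k, j) in
       ((a + (l + 2) * \<theta>) * (a + 1 + l * \<theta>)) /
       ((a + (l + 1) * \<theta>) * (a + 1 + (l + 1) * \<theta>)))"
  proof (rule prod_mono, safe)
    fix k assume "k \<in> {1..<i}"
    then have k: "(k, j) \<in> \<mu>" using addable_row_col(2)[OF assms(1)] by auto
    define a l where "a = arm \<mu> (k, j)" and "l = leg \<mu> (k, j)"
    have al: "0 \<le> a" "0 \<le> l"
      using arm_nonneg[OF y(1) k] leg_nonneg[OF y(1) k] by (auto simp: a_def l_def)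
    have d: "0 < a + (l + 1) * \<theta>" "0 < a + 1 + (l + 1) * \<theta>"
      using al assms(2) mult_pos_pos[of "l + 1" \<theta>] by linarith+
    have 1: "1 \<le> (a + (l + 2) * \<theta>) / (a + (l + 1) * \<theta>)"
      using d(1) assms(2) by (simp add: algebra_simps)
    \<comment> \<open>The right side exceeds the left one by
      \<open>\<theta> * (a + l * \<theta>)\<close>.\<close>
    have "a + 1 + (l + 1) * \<theta> \<le> (a + 1 + l * \<theta>) * (1 + \<theta>)"
      using al assms(2) by (simp add: algebra_simps)
    then have 2: "1 / (1 + \<theta>) \<le> (a + 1 + l * \<theta>) / (a + 1 + (l + 1) * \<theta>)"
      using d(2) assms(2) by (simp add: pos_le_divide_eq pos_divide_le_eq)
    have "1 * (1 / (1 + \<theta>)) \<le> (a + (l + 2) * \<theta>) / (a + (l + 1) * \<theta>) *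
        ((a + 1 + l * \<theta>) / (a + 1 + (l + 1) * \<theta>))"
      by (rule mult_mono[OF 1 2]) (use 1 assms(2) in auto)
    then show "1 / (1 + \<theta>) \<le> (let a = arm \<mu> (k, j); l = leg \<mu> (k, j) in
       ((a + (l + 2) * \<theta>) * (a + 1 + l * \<theta>)) /
       ((a + (l + 1) * \<theta>) * (a + 1 + (l + 1) * \<theta>)))"
      by (simp add: Let_def a_def l_def)
  qed (use assms(2) in auto)
  ultimately show ?thesis by (simp add: jack_mult_def)
qed

text \<open>The part of the lower bound on the transition weight that the Plancherel measure and the
  z-measures share. It depends on the added box but not on the diagram.\<close>

definition step_bound :: "real \<Rightarrow> box \<Rightarrow> real" where
  "step_bound \<theta> b = (1 / (1 + \<theta>)) ^ (fst b - 1) / (\<theta> * (2 + 1 / \<theta>) ^ (fst b + snd b))"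

lemma step_bound_pos: "\<theta> > 0 \<Longrightarrow> 0 < step_bound \<theta> b"
  by (simp add: step_bound_def add_pos_pos)

text \<open>Combines the two estimates. Both choices of \<open>\<phi>\<close> carry the hook product
  in the denominator, so multiplying by their remaining factors gives the bound on transition
  weights.\<close>

lemma jack_div_hook_ge:
  assumes "\<mu> \<nearrow> insert b \<mu>" "\<theta> > 0"
  shows "step_bound \<theta> b / hook_prod \<theta> \<mu> \<le>
    jack_mult \<theta> \<mu> (insert b \<mu>) / hook_prod \<theta> (insert b \<mu>)"
proof -
  obtain i j where b: "b = (i, j)" by (cases b)
  note y = young_edge_insertD[OF assms(1)]
  define J where "J = (1 / (1 + \<theta>)) ^ (i - 1)"
  define C where "C = \<theta> * (2 + 1 / \<theta>) ^ (i + j)"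
  have J: "0 \<le> J" "J \<le> jack_mult \<theta> \<mu> (insert b \<mu>)"
    using jack_mult_insert_ge[of \<mu> i j \<theta>] assms by (simp_all add: J_def b)
  have "hook_prod \<theta> (insert b \<mu>) \<le> C * hook_prod \<theta> \<mu>"
    using hook_prod_insert_le[of \<mu> i j \<theta>] assms by (simp add: C_def b)
  then have "J / (C * hook_prod \<theta> \<mu>) \<le>
      jack_mult \<theta> \<mu> (insert b \<mu>) / hook_prod \<theta> (insert b \<mu>)"
    using J hook_prod_pos[OF y(2) assms(2)] by (intro frac_le) auto
  then show ?thesis by (simp add: step_bound_def J_def C_def b)
qed

section \<open>Events determined by finitely many steps\<close>

lemma Tab_young:
  assumes "\<tau> \<in> Tab"
  shows "young_diagram (\<tau> n)"
  using assms unfolding Tab_def young_edge_def by blast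

lemma Tab_mono:
  assumes "\<tau> \<in> Tab" "m \<le> n"
  shows "\<tau> m \<subseteq> \<tau> n"
  by (rule lift_Suc_mono_le[OF _ assms(2)]) (use assms(1) in \<open>auto simp: Tab_def young_edge_def\<close>)

lemma Tab_card:
  assumes "\<tau> \<in> Tab"
  shows "card (\<tau> n) = n"
proof (induction n)
  case 0
  then show ?case using assms by (simp add: Tab_def)
next
  case (Suc n)
  obtain b where "b \<notin> \<tau> n" "\<tau> (Suc n) = insert b (\<tau> n)"
    using assms unfolding Tab_def young_edge_def by blast
  then show ?case
    using Suc Tab_young[OF assms, of n] by (simp add: young_diagram_def)
qed

text \<open>A box \<open>(r, s)\<close> forces \<open>r\<close> boxes in its column and
  \<open>s\<close> in its row. This confines all diagrams of a given size to one finite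
  square.\<close>

lemma young_diagram_subset_square:
  assumes "young_diagram \<mu>"
  shows "\<mu> \<subseteq> {1..card \<mu>} \<times> {1..card \<mu>}"
proof safe
  fix r s assume rs: "(r, s) \<in> \<mu>"
  have fin: "finite \<mu>" using assms by (simp add: young_diagram_def)
  note pos = young_diagram_pos[OF assms rs]
  have "{1..r} \<times> {s} \<subseteq> \<mu>" "{r} \<times> {1..s} \<subseteq> \<mu>"
    using young_diagram_down[OF assms rs] pos by auto
  from card_mono[OF fin this(1)] card_mono[OF fin this(2)] pos
  show "r \<in> {1..card \<mu>}" "s \<in> {1..card \<mu>}"
    by (simp_all add: card_cartesian_product)
qed

text \<open>Restriction to \<open>{..n}\<close> picks a canonical function for each prefix, with the
  value \<open>undefined\<close> beyond \<open>n\<close>; prefixes then form a finite set.\<close>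

lemma Cyl_restrict [simp]: "Cyl n (restrict \<tau> {..n}) = Cyl n \<tau>"
  by (auto simp: Cyl_def)

lemma finite_prefixes:
  assumes "A \<subseteq> Tab"
  shows "finite ((\<lambda>\<tau>. restrict \<tau> {..n}) ` A)"
proof (rule finite_subset)
  show "finite ({..n} \<rightarrow>\<^sub>E Pow ({1..n} \<times> {1..n}))"
    by (intro finite_PiE) auto
  have "\<tau> m \<subseteq> {1..n} \<times> {1..n}" if "\<tau> \<in> A" "m \<le> n" for \<tau> m
    using young_diagram_subset_square[OF Tab_young, of \<tau> n] Tab_card[of \<tau> n]
      Tab_mono[of \<tau> m n] that assms by auto
  then show "(\<lambda>\<tau>. restrict \<tau> {..n}) ` A \<subseteq> ({..n} \<rightarrow>\<^sub>E Pow ({1..n} \<times> {1..n}))"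
    by (intro image_subsetI PiE_I) auto
qed

text \<open>A cylinder is the trace on \<open>Tab\<close> of a basic open set of the product:
  singletons up to \<open>n\<close>, the whole space afterwards.\<close>

lemma openin_Cyl: "openin tab_topology (Cyl n \<sigma>)"
proof -
  have "openin (product_topology (\<lambda>_. discrete_topology UNIV) UNIV)
      (\<Pi>\<^sub>E m\<in>UNIV. if m \<le> n then {\<sigma> m} else (UNIV :: diagram set))"
    by (rule product_topology_basis) (auto intro: finite_subset[of _ "{..n}"] split: if_splits)
  moreover have "Cyl n \<sigma> =
      (\<Pi>\<^sub>E m\<in>UNIV. if m \<le> n then {\<sigma> m} else (UNIV :: diagram set)) \<inter> Tab"
    by (auto simp: Cyl_def PiE_iff split: if_splits)
  ultimately show ?thesis
    unfolding tab_topology_def openin_subtopology by blast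
qed

text \<open>Events depending on the first \<open>n\<close> steps only, phrased as being closed under
  passing to another path with the same prefix.\<close>

definition determined :: "nat \<Rightarrow> (nat \<Rightarrow> diagram) set \<Rightarrow> bool" where
  "determined n A \<longleftrightarrow> A \<subseteq> Tab \<and> (\<forall>\<tau>\<in>A. Cyl n \<tau> \<subseteq> A)"

lemma determined_eq_UN:
  assumes "determined n A"
  shows "A = (\<Union>\<sigma>\<in>(\<lambda>\<tau>. restrict \<tau> {..n}) ` A. Cyl n \<sigma>)"
  using assms by (force simp: determined_def Cyl_def)

text \<open>A path common to two cylinders makes their representatives agree up to \<open>n\<close>;
  beyond that both are \<open>undefined\<close>, so they coincide.\<close>

lemma disjoint_Cyl:
  "disjoint_family_on (Cyl n) ((\<lambda>\<tau>. restrict \<tau> {..n}) ` A)"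
  by (fastforce simp: disjoint_family_on_def Cyl_def restrict_def)

section \<open>Transition probabilities and almost sure growth for a general central measure\<close>

locale central_measure =
  fixes \<theta> :: real and \<phi> :: "diagram \<Rightarrow> real" and M :: "(nat \<Rightarrow> diagram) measure"
  assumes central: "central_measure_of \<theta> \<phi> M"
begin

sublocale prob_space M
  using central by (simp add: central_measure_of_def)

lemma space_eq: "space M = Tab"
  using central by (simp add: central_measure_of_def)

lemma prob_Cyl: "finite_path n \<sigma> \<Longrightarrow> prob (Cyl n \<sigma>) = path_mult \<theta> n \<sigma> * \<phi> (\<sigma> n)"
  using central by (simp add: central_measure_of_def)

lemma Cyl_in_events: "Cyl n \<sigma> \<in> events"
proof -
  have "{U. openin tab_topology U} \<subseteq> Pow Tab"
    using openin_subset by (fastforce simp: tab_topology_def)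
  then have "sets tab_borel = sigma_sets Tab {U. openin tab_topology U}"
    by (simp add: tab_borel_def)
  then show ?thesis
    using central openin_Cyl[of n \<sigma>] by (auto simp: central_measure_of_def)
qed

lemma determined_in_events:
  assumes "determined n A"
  shows "A \<in> events"
  by (subst determined_eq_UN[OF assms], intro sets.finite_UN)
    (use assms finite_prefixes Cyl_in_events in \<open>auto simp: determined_def\<close>)

text \<open>Given a prefix ending at \<open>\<mu>\<close>, the next step adds \<open>b\<close> with
  probability \<open>jack_mult \<theta> \<mu> (insert b \<mu>) * \<phi> (insert b \<mu>) / \<phi>
  \<mu>\<close>, which is at least \<open>p\<close>. Summing over the finitely many prefixes in
  \<open>A\<close> gives the claim.\<close>

lemma prob_step_ge:
  assumes A: "determined n A"
    and add: "\<And>\<tau>. \<tau> \<in> A \<Longrightarrow> \<tau> n \<nearrow> insert b (\<tau> n)"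
    and step: "\<And>\<mu>. \<mu> \<nearrow> insert b \<mu> \<Longrightarrow> card \<mu> = n \<Longrightarrow>
      p * \<phi> \<mu> \<le> jack_mult \<theta> \<mu> (insert b \<mu>) * \<phi> (insert b \<mu>)"
    and pos: "\<And>\<mu>. young_diagram \<mu> \<Longrightarrow> 0 < \<phi> \<mu>"
  shows "p * prob A \<le> prob {\<tau> \<in> A. b \<in> \<tau> (Suc n)}"
proof -
  define S where "S = (\<lambda>\<tau>. restrict \<tau> {..n}) ` A"
  \<comment> \<open>Prolongs a prefix by the step that adds \<open>b\<close>.\<close>
  define ext where "ext = (\<lambda>\<sigma> :: nat \<Rightarrow> diagram. \<sigma>(Suc n := insert b (\<sigma> n)))"
  have AT: "A \<subseteq> Tab" using A by (simp add: determined_def)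
  have fin: "finite S" unfolding S_def by (rule finite_prefixes[OF AT])
  have sub: "Cyl (Suc n) (ext \<sigma>) \<subseteq> Cyl n \<sigma>" for \<sigma>
    by (auto simp: Cyl_def ext_def le_Suc_eq)
  have disj: "disjoint_family_on (Cyl n) S"
    unfolding S_def by (rule disjoint_Cyl)
  have Cyl_le: "p * prob (Cyl n \<sigma>) \<le> prob (Cyl (Suc n) (ext \<sigma>))" if \<sigma>S: "\<sigma> \<in> S" for \<sigma>
  proof -
    obtain \<tau> where \<tau>: "\<tau> \<in> A" "\<sigma> = restrict \<tau> {..n}"
      using \<sigma>S S_def by blast
    have \<tau>T: "\<tau> \<in> Tab" using \<tau> AT by blast
    have fp: "finite_path n \<sigma>"
      using \<tau>T by (auto simp: \<tau>(2) finite_path_def Tab_def)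
    have edge: "\<sigma> n \<nearrow> insert b (\<sigma> n)" using add[OF \<tau>(1)] \<tau>(2) by simp
    have fp': "finite_path (Suc n) (ext \<sigma>)"
      using fp edge by (auto simp: finite_path_def ext_def less_Suc_eq)
    have "path_mult \<theta> (Suc n) (ext \<sigma>) =
        path_mult \<theta> n \<sigma> * jack_mult \<theta> (\<sigma> n) (insert b (\<sigma> n))"
    proof -
      have "(\<Prod>m\<in>{1..n}. jack_mult \<theta> (ext \<sigma> (m - 1)) (ext \<sigma> m)) = path_mult \<theta> n \<sigma>"
        unfolding path_mult_def by (rule prod.cong) (auto simp: ext_def)
      then show ?thesis
        unfolding path_mult_def by (simp add: ext_def)
    qed
    then have eq: "prob (Cyl (Suc n) (ext \<sigma>)) =
        path_mult \<theta> n \<sigma> * (jack_mult \<theta> (\<sigma> n) (insert b (\<sigma> n)) * \<phi> (insert b (\<sigma> n)))"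
      using prob_Cyl[OF fp'] by (simp add: ext_def)
    \<comment> \<open>The sign of \<open>path_mult\<close> is read off from the measure: its product
      with the positive number \<open>\<phi> (\<sigma> n)\<close> is a probability.\<close>
    have "0 < \<phi> (\<sigma> n)" by (rule pos) (use young_edge_insertD[OF edge] in simp)
    moreover have "0 \<le> path_mult \<theta> n \<sigma> * \<phi> (\<sigma> n)"
      using prob_Cyl[OF fp] measure_nonneg[of M "Cyl n \<sigma>"] by simp
    ultimately have "0 \<le> path_mult \<theta> n \<sigma>"
      by (simp add: zero_le_mult_iff)
    moreover have "card (\<sigma> n) = n" using Tab_card[OF \<tau>T] \<tau>(2) by simp
    ultimately have "path_mult \<theta> n \<sigma> * (p * \<phi> (\<sigma> n)) \<le> prob (Cyl (Suc n) (ext \<sigma>))"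
      unfolding eq by (intro mult_left_mono step edge)
    then show ?thesis using prob_Cyl[OF fp] by (simp add: mult_ac)
  qed
  have "prob A = (\<Sum>\<sigma>\<in>S. prob (Cyl n \<sigma>))"
    by (subst determined_eq_UN[OF A], fold S_def, intro finite_measure_finite_Union)
      (use fin disj Cyl_in_events in auto)
  then have "p * prob A \<le> (\<Sum>\<sigma>\<in>S. prob (Cyl (Suc n) (ext \<sigma>)))"
    by (simp add: sum_distrib_left sum_mono Cyl_le)
  also have "\<dots> = prob (\<Union>\<sigma>\<in>S. Cyl (Suc n) (ext \<sigma>))"
  proof (rule finite_measure_finite_Union[symmetric, OF fin])
    show "disjoint_family_on (\<lambda>\<sigma>. Cyl (Suc n) (ext \<sigma>)) S"
      using disj sub unfolding disjoint_family_on_def by blast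
  qed (use Cyl_in_events in blast)
  also have "\<dots> \<le> prob {\<tau> \<in> A. b \<in> \<tau> (Suc n)}"
  proof (rule finite_measure_mono)
    have "(\<Union>\<sigma>\<in>S. Cyl (Suc n) (ext \<sigma>)) \<subseteq> A"
      using sub determined_eq_UN[OF A] unfolding S_def by blast
    moreover have "b \<in> \<tau> (Suc n)" if "\<tau> \<in> Cyl (Suc n) (ext \<sigma>)" for \<tau> \<sigma>
      using that by (simp add: Cyl_def ext_def)
    ultimately show "(\<Union>\<sigma>\<in>S. Cyl (Suc n) (ext \<sigma>)) \<subseteq> {\<tau> \<in> A. b \<in> \<tau> (Suc n)}"
      by blast
    have "determined (Suc n) {\<tau> \<in> A. b \<in> \<tau> (Suc n)}"
      using A by (fastforce simp: determined_def Cyl_def)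
    then show "{\<tau> \<in> A. b \<in> \<tau> (Suc n)} \<in> events" by (rule determined_in_events)
  qed
  finally show ?thesis .
qed

text \<open>Let \<open>B\<close> be the event that \<open>b\<close> is addable at time
  \<open>N\<close> but never added. At each later step at least \<open>p (N + n) * prob B\<close> of
  the mass moves to paths containing \<open>b\<close>. The total mass is at most 1, so
  \<open>prob B > 0\<close> would make \<open>p\<close> summable.\<close>

lemma AE_addable_added:
  assumes step: "\<And>\<mu>. \<mu> \<nearrow> insert b \<mu> \<Longrightarrow>
      p (card \<mu>) * \<phi> \<mu> \<le> jack_mult \<theta> \<mu> (insert b \<mu>) * \<phi> (insert b \<mu>)"
    and pos: "\<And>\<mu>. young_diagram \<mu> \<Longrightarrow> 0 < \<phi> \<mu>"
    and p: "\<And>n. 0 \<le> p n" "\<not> summable p"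
  shows "AE \<tau> in M. \<tau> N \<nearrow> insert b (\<tau> N) \<longrightarrow> b \<in> (\<Union>n. \<tau> n)"
proof -
  define A where "A n = {\<tau> \<in> Tab. \<tau> N \<nearrow> insert b (\<tau> N) \<and> b \<notin> \<tau> (N + n)}" for n
  define B where "B = (\<Inter>n. A n)"
  have A: "determined (N + n) (A n)" for n
    by (auto simp: determined_def Cyl_def A_def)
  note Aev = determined_in_events[OF A]
  have Bev: "B \<in> events" unfolding B_def by (intro sets.countable_INT) (use Aev in auto)
  have drop: "p (N + n) * prob B \<le> prob (A n) - prob (A (Suc n))" for n
  proof -
    \<comment> \<open>Since \<open>B\<close> lies in every \<open>A n\<close>, the drop is bounded
      below by \<open>p\<close> times a factor that does not vary with \<open>n\<close>.\<close>
    have "p (N + n) * prob B \<le> p (N + n) * prob (A n)"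
      by (intro mult_left_mono finite_measure_mono p Aev) (auto simp: B_def)
    also have "\<dots> \<le> prob {\<tau> \<in> A n. b \<in> \<tau> (Suc (N + n))}"
    proof (rule prob_step_ge[OF A _ _ pos])
      fix \<tau> assume "\<tau> \<in> A n"
      show "\<tau> (N + n) \<nearrow> insert b (\<tau> (N + n))"
        by (rule young_edge_insert_mono[of "\<tau> N"])
          (use \<open>\<tau> \<in> A n\<close> Tab_mono[of \<tau> N "N + n"] in \<open>auto simp: A_def Tab_young\<close>)
    next
      fix \<mu> assume "\<mu> \<nearrow> insert b \<mu>" "card \<mu> = N + n"
      then show "p (N + n) * \<phi> \<mu> \<le> jack_mult \<theta> \<mu> (insert b \<mu>) * \<phi> (insert b \<mu>)"
        using step[of \<mu>] by simp
    qed
    also have "{\<tau> \<in> A n. b \<in> \<tau> (Suc (N + n))} = A n - A (Suc n)"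
      by (auto simp: A_def)
    also have "prob (A n - A (Suc n)) = prob (A n) - prob (A (Suc n))"
    proof (rule finite_measure_Diff[OF Aev Aev])
      show "A (Suc n) \<subseteq> A n"
        using Tab_mono[of _ "N + n" "N + Suc n"] by (auto simp: A_def)
    qed
    finally show ?thesis .
  qed
  have "prob B = 0"
  proof (rule ccontr)
    assume "prob B \<noteq> 0"
    then have Bpos: "0 < prob B" by (simp add: zero_less_measure_iff)
    have "summable (\<lambda>n. p (n + N))"
    proof (rule summableI_nonneg_bounded)
      fix n
      \<comment> \<open>The drops telescope, which bounds all partial sums of \<open>p\<close> at
        once.\<close>
      have "(\<Sum>k<n. p (k + N)) * prob B \<le> (\<Sum>k<n. prob (A k) - prob (A (Suc k)))"
        using drop by (simp add: sum_distrib_right sum_mono add.commute)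
      also have "\<dots> = prob (A 0) - prob (A n)" by (rule sum_lessThan_telescope')
      also have "\<dots> \<le> 1" using prob_le_1[of "A 0"] measure_nonneg[of M "A n"] by linarith
      finally show "(\<Sum>k<n. p (k + N)) \<le> 1 / prob B"
        using Bpos by (simp add: pos_le_divide_eq)
    qed (rule p)
    then show False using p(2) summable_iff_shift[of p N] by blast
  qed
  then have "AE \<tau> in M. \<tau> \<notin> B"
    using Bev by (simp add: prob_eq_0)
  moreover have "AE \<tau> in M. \<tau> \<in> Tab"
    using AE_space[of M] by (simp add: space_eq)
  ultimately show ?thesis
    by eventually_elim (auto simp: B_def A_def)
qed

text \<open>Induction on \<open>i + j\<close>: the left and upper neighbours are almost surely
  reached, and once both are present the box is either there already or addable, hence almost surely
  added.\<close>

lemma completely_reachable_if: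
  assumes step: "\<And>b \<mu>. \<mu> \<nearrow> insert b \<mu> \<Longrightarrow>
      p b (card \<mu>) * \<phi> \<mu> \<le> jack_mult \<theta> \<mu> (insert b \<mu>) * \<phi> (insert b \<mu>)"
    and pos: "\<And>\<mu>. young_diagram \<mu> \<Longrightarrow> 0 < \<phi> \<mu>"
    and p: "\<And>b n. 0 \<le> p b n" "\<And>b. \<not> summable (p b)"
  shows "1 \<le> i \<Longrightarrow> 1 \<le> j \<Longrightarrow> completely_reachable M (i, j)"
proof (induction "i + j" arbitrary: i j rule: less_induct)
  case less
  \<comment> \<open>The time at which the box becomes addable depends on the path, so one null set
    has to serve all \<open>N\<close>; this works because there are countably many.\<close>
  have "AE \<tau> in M. \<forall>N. \<tau> N \<nearrow> insert (i, j) (\<tau> N) \<longrightarrow> (i, j) \<in> (\<Union>n. \<tau> n)"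
    unfolding AE_all_countable
    by (intro allI AE_addable_added[of "(i, j)" "p (i, j)"] step pos p)
  moreover have "AE \<tau> in M. 1 < i \<longrightarrow> (i - 1, j) \<in> (\<Union>n. \<tau> n)"
    using less.hyps[of "i - 1" j] less.prems by (auto simp: completely_reachable_def)
  moreover have "AE \<tau> in M. 1 < j \<longrightarrow> (i, j - 1) \<in> (\<Union>n. \<tau> n)"
    using less.hyps[of i "j - 1"] less.prems by (auto simp: completely_reachable_def)
  moreover have "AE \<tau> in M. \<tau> \<in> Tab"
    using AE_space[of M] by (simp add: space_eq)
  ultimately show ?case
    unfolding completely_reachable_def
  proof eventually_elim
    case (elim \<tau>)
    show ?case
    proof (rule ccontr)
      assume no: "(i, j) \<notin> (\<Union>n. \<tau> n)"
      obtain m1 where m1: "1 < i \<longrightarrow> (i - 1, j) \<in> \<tau> m1" using elim(2) by auto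
      obtain m2 where m2: "1 < j \<longrightarrow> (i, j - 1) \<in> \<tau> m2" using elim(3) by auto
      have "\<tau> m1 \<subseteq> \<tau> (max m1 m2)" "\<tau> m2 \<subseteq> \<tau> (max m1 m2)"
        by (rule Tab_mono[OF elim(4)], simp)+
      then have "\<tau> (max m1 m2) \<nearrow> insert (i, j) (\<tau> (max m1 m2))"
        using m1 m2 no less.prems Tab_young[OF elim(4)] by (intro young_edge_insertI) auto
      then show False using elim(1) no by blast
    qed
  qed
qed

end

section \<open>The Plancherel measure and the z-measures\<close>

lemma plancherel_completely_reachable:
  assumes "\<theta> > 0" "plancherel_measure \<theta> M" "1 \<le> i" "1 \<le> j"
  shows "completely_reachable M (i, j)"
proof -
  interpret central_measure \<theta> "phi_plancherel \<theta>" M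
    using assms(2) by unfold_locales (simp add: plancherel_measure_def)
  show ?thesis
  proof (rule completely_reachable_if[where p = "\<lambda>b n. \<theta> * step_bound \<theta> b"])
    fix b \<mu> assume edge: "\<mu> \<nearrow> insert b \<mu>"
    note y = young_edge_insertD[OF edge]
    have card: "card (insert b \<mu>) = Suc (card \<mu>)"
      using y by (simp add: young_diagram_def)
    show "\<theta> * step_bound \<theta> b * phi_plancherel \<theta> \<mu> \<le>
        jack_mult \<theta> \<mu> (insert b \<mu>) * phi_plancherel \<theta> (insert b \<mu>)"
      \<comment> \<open>One factor \<open>\<theta>\<close> of the power goes into the transition
        bound, the others into \<open>phi_plancherel \<theta> \<mu>\<close>.\<close>
      using mult_left_mono[OF jack_div_hook_ge[OF edge assms(1)], of "\<theta> ^ Suc (card \<mu>)"] assms(1)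
      unfolding phi_plancherel_def card by (simp add: mult_ac)
  next
    fix b show "\<not> summable (\<lambda>n :: nat. \<theta> * step_bound \<theta> b)"
      using assms(1) step_bound_pos[OF assms(1), of b] by (simp add: summable_const_iff)
  qed (use assms step_bound_pos[OF assms(1)] hook_prod_pos in
      \<open>auto simp: phi_plancherel_def less_imp_le\<close>)
qed

text \<open>Adding \<open>b\<close> to a diagram with \<open>n\<close> boxes multiplies
  \<open>phi_z\<close> by \<open>w b / (t + n)\<close> and a ratio of hook products. The resulting
  bounds are positive multiples of \<open>1 / (t + n)\<close> and diverge like the harmonic
  series.\<close>

lemma z_measure_completely_reachable:
  assumes "\<theta> > 0" "z_measure \<theta> z M" "1 \<le> i" "1 \<le> j"
    and z: "\<And>m n :: int. z \<noteq> of_int m + of_int n * of_real \<theta>"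
  shows "completely_reachable M (i, j)"
proof -
  interpret central_measure \<theta> "phi_z \<theta> z" M
    using assms(2) by unfold_locales (simp add: z_measure_def)
  define t where "t = (cmod z)\<^sup>2 / \<theta>"
  have t: "0 < t" using z[of 0 0] assms(1) by (simp add: t_def)
  define w where "w = (\<lambda>b. (cmod (z + of_real (content \<theta> b)))\<^sup>2)"
  have w: "0 < w b" for b
  proof -
    obtain r s where b: "b = (r, s)" by (cases b)
    \<comment> \<open>If this sum vanished, \<open>z\<close> would be the lattice point
      \<open>(1 - s) + (r - 1) * \<theta>\<close>.\<close>
    have "z + of_real (content \<theta> b) \<noteq> 0"
      using z[of "1 - int s" "int r - 1"]
      by (auto simp: b content_def algebra_simps add_eq_0_iff)
    then show ?thesis by (simp add: w_def)
  qed
  have poch: "0 < pochhammer t n" for n using t by (simp add: pochhammer_pos)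
  show ?thesis
  proof (rule completely_reachable_if[where p = "\<lambda>b n. w b * step_bound \<theta> b / (t + real n)"])
    fix b \<mu> assume edge: "\<mu> \<nearrow> insert b \<mu>"
    note y = young_edge_insertD[OF edge]
    have fin: "finite \<mu>" using y(1) by (simp add: young_diagram_def)
    have card: "card (insert b \<mu>) = Suc (card \<mu>)" using y fin by simp
    \<comment> \<open>The factor common to both sides; its denominator is
      \<open>pochhammer t (Suc (card \<mu>))\<close>.\<close>
    define c where "c = prod w \<mu> * w b / (pochhammer t (card \<mu>) * (t + real (card \<mu>)))"
    have c: "0 \<le> c"
      unfolding c_def using w poch[of "card \<mu>"] t
      by (intro divide_nonneg_nonneg mult_nonneg_nonneg prod_nonneg) (auto simp: less_imp_le)
    have "w b * step_bound \<theta> b / (t + real (card \<mu>)) * phi_z \<theta> z \<mu> =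
        c * (step_bound \<theta> b / hook_prod \<theta> \<mu>)"
      by (simp add: phi_z_def c_def w_def t_def mult_ac)
    also have "\<dots> \<le> c * (jack_mult \<theta> \<mu> (insert b \<mu>) / hook_prod \<theta> (insert b \<mu>))"
      by (rule mult_left_mono[OF jack_div_hook_ge[OF edge assms(1)] c])
    also have "\<dots> = jack_mult \<theta> \<mu> (insert b \<mu>) * phi_z \<theta> z (insert b \<mu>)"
      unfolding phi_z_def card using fin y(3)
      by (simp add: c_def w_def t_def pochhammer_Suc mult_ac)
    finally show "w b * step_bound \<theta> b / (t + real (card \<mu>)) * phi_z \<theta> z \<mu> \<le>
        jack_mult \<theta> \<mu> (insert b \<mu>) * phi_z \<theta> z (insert b \<mu>)" .
  next
    fix \<mu> assume "young_diagram \<mu>"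
    then have "0 < prod w \<mu> / (pochhammer t (card \<mu>) * hook_prod \<theta> \<mu>)"
      using w poch hook_prod_pos[OF _ assms(1)]
      by (intro divide_pos_pos mult_pos_pos prod_pos) auto
    then show "0 < phi_z \<theta> z \<mu>" by (simp add: phi_z_def w_def t_def)
  next
    fix b
    define c where "c = w b * step_bound \<theta> b"
    have c: "0 < c" using w step_bound_pos[OF assms(1)] by (simp add: c_def)
    show "\<not> summable (\<lambda>n. w b * step_bound \<theta> b / (t + real n))"
      unfolding c_def[symmetric]
    proof
      assume s: "summable (\<lambda>n. c / (t + real n))"
      have "summable (\<lambda>n. (t + 1) / c * (c / (t + real n)))"
        by (rule summable_mult[OF s])
      then have "summable (\<lambda>n. inverse (real (Suc n)))"
      proof (rule summable_comparison_test'[where N = 0])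
        fix n :: nat
        \<comment> \<open>Yields \<open>1 / (n + 1) \<le> (t + 1) / (t + n)\<close>, the comparison
          with the harmonic series; this is why the series was rescaled by
          \<open>(t + 1) / c\<close>.\<close>
        have "t + real n \<le> (t + 1) * real (Suc n)"
          using t by (simp add: algebra_simps)
        then have "(t + 1) / ((t + 1) * real (Suc n)) \<le> (t + 1) / (t + real n)"
          using t by (intro frac_le) auto
        then show "norm (inverse (real (Suc n))) \<le> (t + 1) / c * (c / (t + real n))"
          using t c by (simp add: inverse_eq_divide)
      qed
      then show False
        using not_summable_harmonic[where 'a = real] summable_Suc_iff[of "\<lambda>n. inverse (real n)"]
        by simp
    qed
  next
    fix b n show "0 \<le> w b * step_bound \<theta> b / (t + real n)"
      using w[of b] step_bound_pos[OF assms(1), of b] t by simp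
  qed (use assms in auto)
qed

theorem theorem2p3p1:
  fixes \<theta> :: real and M :: "(nat \<Rightarrow> diagram) measure" and i j :: nat
  assumes "\<theta> > 0"
    and "plancherel_measure \<theta> M \<or>
      (\<exists>z :: complex. (\<forall>m n :: int. z \<noteq> of_int m + of_int n * of_real \<theta>) \<and> z_measure \<theta> z M)"
    and "1 \<le> i" and "1 \<le> j"
  shows "completely_reachable M (i, j)"
  using assms plancherel_completely_reachable z_measure_completely_reachable by blast

end
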